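(* Let $n\in\mathbb{N}$. Then the number of negative real roots of the Yablonskii--Vorob'ev polynomial $Q_n$ is $$\left|Z_n\cap(-\infty,0)\right|=\left[\frac{n+1}{3}\right],$$ and the number of positive real roots of $Q_n$ is $$\left|Z_n\cap(0,\infty)\right|=\begin{cases}\left[\dfrac{n}{6}\right]&\text{if $n$ is even,}\\ \left[\dfrac{n+3}{6}\right]&\text{if $n$ is odd.}\end{cases}$$
   Context: $\mathbb{N}=\{0,1,2,\ldots\}$. The Yablonskii--Vorob'ev polynomials $Q_n$ ($n\in\mathbb{N}$) are the polynomials in $z$ defined by $Q_0=1$, $Q_1=z$ and, for $n\ge 1$, the differential-difference equation $$Q_{n+1}Q_{n-1}=zQ_n^2-4\big(Q_nQ_n''-(Q_n')^2\big),$$ where $'$ denotes $d/dz$. (It is known that each $Q_n$ is a monic polynomial of degree $\tfrac12 n(n+1)$ with integer coefficients.) For $n\in\mathbb{N}$, $Z_n$ denotes the set of real roots of $Q_n$, and $|S|$ denotes the cardinality of a set $S$. For a real number $x$, $[x]$ denotes the integer part of $x$. *)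

theory Defs
  imports
    "HOL-Computational_Algebra.Computational_Algebra"
    "HOL-Computational_Algebra.Field_as_Ring"
begin

abbreviation zvar :: "real poly" where
  "zvar \<equiv> [:0, 1:]"

definition toda :: "real poly \<Rightarrow> real poly" where
  "toda q = zvar * q\<^sup>2 - 4 * (q * pderiv (pderiv q) - (pderiv q)\<^sup>2)"

text \<open>The recurrence is solved for its highest member by Euclidean division of
  polynomials. The division is always exact: see \<open>YV_recurrence\<close> at the end of this theory.\<close>

fun YV :: "nat \<Rightarrow> real poly" where
  "YV 0 = 1"
| "YV (Suc 0) = zvar"
| "YV (Suc (Suc n)) = toda (YV (Suc n)) div YV n"

definition YV_real_roots :: "nat \<Rightarrow> real set" where
  "YV_real_roots n = {x. poly (YV n) x = 0}"


section \<open>Exactness of the division\<close>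

definition hir2 :: "real poly \<Rightarrow> real poly" where
  "hir2 q = q * pderiv (pderiv q) - (pderiv q)\<^sup>2"

lemma toda_hir2: "toda q = zvar * q\<^sup>2 - 4 * hir2 q"
  by (simp add: toda_def hir2_def)

lemma pderiv_zvar: "pderiv zvar = 1"
  by (simp add: pderiv_pCons)

lemma pderiv_four: "pderiv (4 :: real poly) = 0"
  using pderiv_of_nat[of 4, where ?'a = real] by simp

lemma hir2_mult: "hir2 (p * q) = p\<^sup>2 * hir2 q + q\<^sup>2 * hir2 p"
  unfolding hir2_def by (simp add: pderiv_mult pderiv_add algebra_simps power2_eq_square)

lemma hir2_power: "hir2 (p ^ Suc m) = of_nat (Suc m) * p ^ (2 * m) * hir2 p"
proof (induction m)
  case (Suc m)
  have "hir2 (p ^ Suc (Suc m)) = hir2 (p * p ^ Suc m)" by simp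
  also have "\<dots> = p\<^sup>2 * (of_nat (Suc m) * p ^ (2 * m) * hir2 p) + (p ^ Suc m)\<^sup>2 * hir2 p"
    by (simp only: hir2_mult Suc.IH)
  also have "\<dots> = of_nat (Suc (Suc m)) * p ^ (2 * Suc m) * hir2 p"
    by (simp add: algebra_simps power2_eq_square power_mult_distrib power_mult)
  finally show ?case .
qed simp

lemma pderiv_toda:
  "pderiv (toda q) = q\<^sup>2 + 2 * zvar * q * pderiv q
     - 4 * (q * pderiv (pderiv (pderiv q)) - pderiv q * pderiv (pderiv q))"
  unfolding toda_def power2_eq_square pderiv_diff pderiv_mult pderiv_zvar pderiv_four
  by (simp only: algebra_simps)

definition hirota :: "real poly \<Rightarrow> real poly \<Rightarrow> real poly" where
  "hirota h f = f * pderiv (pderiv h) - 2 * pderiv f * pderiv h + pderiv (pderiv f) * h"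

lemma pderiv_two: "pderiv (2 :: real poly) = 0"
  using pderiv_of_nat[of 2, where ?'a = real] by simp

lemma pderiv_hirota:
  "pderiv (hirota h f) = f * pderiv (pderiv (pderiv h)) - pderiv f * pderiv (pderiv h)
     - pderiv (pderiv f) * pderiv h + pderiv (pderiv (pderiv f)) * h"
  unfolding hirota_def pderiv_diff pderiv_add pderiv_mult pderiv_two
  by (simp only: algebra_simps)

lemma toda_hirota:
  fixes c :: "real poly"
  defines "T \<equiv> toda"
  shows
  "h * (pderiv (T f) * h - 2 * T f * pderiv h - (c + 2) * f\<^sup>2 * h)
     + f * (pderiv (T h) * f - 2 * T h * pderiv f + c * f * h\<^sup>2)
   = - 4 * (pderiv (hirota h f) * f * h - hirota h f * (pderiv f * h + f * pderiv h))"
proof -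
  define z where "z = zvar"
  define h1 h2 h3 where "h1 = pderiv h" and "h2 = pderiv h1" and "h3 = pderiv h2"
  define f1 f2 f3 where "f1 = pderiv f" and "f2 = pderiv f1" and "f3 = pderiv f2"
  show ?thesis
    unfolding T_def pderiv_toda pderiv_hirota unfolding toda_def hirota_def
      z_def[symmetric] h1_def[symmetric] h2_def[symmetric] h3_def[symmetric]
      f1_def[symmetric] f2_def[symmetric] f3_def[symmetric]
    by (simp add: algebra_simps power2_eq_square)
qed

text \<open>Below \<open>g, h, f, k\<close> stand for four consecutive members of the sequence. The Wronskian
  relation \<open>f' g - f g' = c h\<^sup>2\<close> and the relation \<open>hirota h f = 0\<close> pass to the next index.\<close>

lemma wronskian_step:
  assumes Th: "toda h = f * g" and Tf: "toda f = k * h" and A: "hirota h f = 0"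
    and R: "pderiv f * g - f * pderiv g = c * h\<^sup>2" and nz: "h \<noteq> 0"
  shows "pderiv k * h - k * pderiv h = (c + 2) * f\<^sup>2"
proof -
  have "pderiv (toda h) * f - 2 * toda h * pderiv f + c * f * h\<^sup>2 = 0"
    using R unfolding Th pderiv_mult by algebra
  then have "h * (pderiv (toda f) * h - 2 * toda f * pderiv h - (c + 2) * f\<^sup>2 * h) = 0"
    using toda_hirota[of h f c] A by simp
  then have "pderiv (toda f) * h - 2 * toda f * pderiv h - (c + 2) * f\<^sup>2 * h = 0"
    using nz by simp
  then have "h * (pderiv k * h - k * pderiv h - (c + 2) * f\<^sup>2) = 0"
    unfolding Tf pderiv_mult by algebra
  then show ?thesis using nz by simp
qed

lemma hirota_step:
  assumes R: "pderiv k * h - k * pderiv h = of_nat c * f\<^sup>2"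
    and A: "hirota h f = 0" and nz: "h \<noteq> 0"
  shows "hirota f k = 0"
proof -
  have "pderiv (pderiv k * h - k * pderiv h) = pderiv (of_nat c * f\<^sup>2)"
    using R by simp
  then have R': "pderiv (pderiv k) * h - k * pderiv (pderiv h) = 2 * of_nat c * f * pderiv f"
    unfolding pderiv_diff pderiv_mult power2_eq_square pderiv_of_nat by algebra
  have "h * hirota f k = k * hirota h f"
    using R R' unfolding hirota_def by algebra
  then show ?thesis using A nz by simp
qed

text \<open>Divisibility, up to the factor \<open>g\<^sup>2\<close>.\<close>

lemma dvd_step_aux:
  assumes Th: "toda h = f * g" and d: "h dvd toda g"
  shows "h dvd toda f * g\<^sup>2"
proof -
  define z where "z = zvar"
  define h1 h2 h3 h4 where "h1 = pderiv h" and "h2 = pderiv h1"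
    and "h3 = pderiv h2" and "h4 = pderiv h3"
  define u u1 u2 where "u = toda h" and "u1 = pderiv u" and "u2 = pderiv u1"
  have pderiv_z: "pderiv z = 1" by (simp add: z_def pderiv_pCons)
  have u: "u = z * h\<^sup>2 - 4 * (h * h2 - h1\<^sup>2)"
    by (simp add: u_def toda_def h1_def h2_def z_def del: mult_pCons_left)
  have u1: "u1 = h\<^sup>2 + 2 * z * h * h1 - 4 * (h * h3 - h1 * h2)"
    by (simp add: u1_def u_def pderiv_toda h1_def h2_def h3_def z_def del: mult_pCons_left)
  have u2: "u2 = 4 * h * h1 + 2 * z * h1\<^sup>2 + 2 * z * h * h2 - 4 * (h * h4 - h2\<^sup>2)"
    unfolding u2_def u1 power2_eq_square pderiv_diff pderiv_add pderiv_mult pderiv_z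
      pderiv_four pderiv_two h1_def[symmetric] h2_def[symmetric] h3_def[symmetric]
      h4_def[symmetric]
    by (simp add: algebra_simps)
  have "z * u\<^sup>2 + toda u = 2 * z * u\<^sup>2 - 4 * (u * u2 - u1\<^sup>2)"
    by (simp add: toda_def u1_def u2_def z_def del: mult_pCons_left)
  also have "\<exists>q. \<dots> = h * q"
  proof -
    define v where "v = z * h - 4 * h2"
    define v1 where "v1 = h + 2 * z * h1 - 4 * h3"
    define v2 where "v2 = 4 * h1 + 2 * z * h2 - 4 * h4"
    have "u = h * v + 4 * h1\<^sup>2" "u1 = h * v1 + 4 * h1 * h2"
      "u2 = h * v2 + (2 * z * h1\<^sup>2 + 4 * h2\<^sup>2)"
      unfolding u u1 u2 v_def v1_def v2_def by (simp_all add: algebra_simps power2_eq_square)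
    then have "2 * z * u\<^sup>2 - 4 * (u * u2 - u1\<^sup>2) =
      h * (2 * z * (h * v\<^sup>2 + 8 * v * h1\<^sup>2)
        - 4 * (h * v * v2 + v * (2 * z * h1\<^sup>2 + 4 * h2\<^sup>2) + 4 * h1\<^sup>2 * v2
               - h * v1\<^sup>2 - 8 * v1 * h1 * h2))"
      by (simp add: algebra_simps power2_eq_square)
    then show ?thesis by blast
  qed
  finally have 1: "h dvd z * u\<^sup>2 + toda u" by (auto simp: dvd_def)
  have "toda f * g\<^sup>2 + toda g * f\<^sup>2 = z * u\<^sup>2 + toda u"
    unfolding u_def Th unfolding toda_hir2 hir2_mult z_def[symmetric]
    by (simp add: algebra_simps power2_eq_square)
  then have "toda f * g\<^sup>2 = (z * u\<^sup>2 + toda u) - toda g * f\<^sup>2"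
    by (simp add: algebra_simps)
  then show ?thesis using 1 d by (simp add: dvd_diff)
qed

lemma coprime_step:
  assumes Th: "toda h = f * g" and cop: "coprime g h"
    and R: "pderiv f * g - f * pderiv g = c * h\<^sup>2" and nz: "h \<noteq> 0"
  shows "coprime h f"
proof (rule ccontr)
  assume "\<not> coprime h f"
  then obtain p where p: "prime_elem p" "p dvd h" "p dvd f"
  proof -
    assume *: thesis if "prime_elem p" "p dvd h" "p dvd f" for p
    have "gcd h f \<noteq> 0" "\<not> is_unit (gcd h f)"
      using nz \<open>\<not> coprime h f\<close> by (auto simp: coprime_iff_gcd_eq_1 is_unit_gcd_iff)
    then obtain p where "prime p" "p dvd gcd h f"
      using prime_divisor_exists by blast
    then show thesis using *[of p] by auto
  qed
  have png: "\<not> p dvd g"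
    using p cop by (meson coprime_common_divisor prime_elem_not_unit)
  have degp: "degree p > 0"
    using p(1) by (metis is_unit_iff_degree gr0I prime_elem_def)
  have pnp': "\<not> p dvd pderiv p"
  proof
    assume "p dvd pderiv p"
    moreover have "pderiv p \<noteq> 0" using degp by (simp add: pderiv_eq_0_iff)
    ultimately have "degree p \<le> degree (pderiv p)" by (rule dvd_imp_degree_le)
    then show False using degp by (simp add: degree_pderiv)
  qed
  have nunit: "\<not> is_unit p" using p(1) by (rule prime_elem_not_unit)
  obtain u where hu: "h = p ^ multiplicity p h * u" and pu: "\<not> p dvd u"
    using multiplicity_decompose'[OF nz nunit] by metis
  define m where "m = multiplicity p h"
  have "m > 0" unfolding m_def using p(2) nz nunit
    by (simp add: multiplicity_gt_zero_iff)
  then obtain a where a: "m = Suc a" by (cases m) auto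
  have h: "h = p ^ Suc a * u" using hu a m_def by simp
  define v where "v = zvar * p\<^sup>2 * u\<^sup>2 - 4 * p\<^sup>2 * hir2 u - 4 * of_nat (Suc a) * u\<^sup>2 * hir2 p"
  have Tv: "toda h = p ^ (2 * a) * v"
    unfolding h toda_hir2 hir2_mult hir2_power v_def
    by (simp add: algebra_simps power2_eq_square power_mult_distrib power_mult)
  have nof: "\<not> p dvd of_nat (Suc b)" for b
    using nunit dvd_unit_imp_unit[of p "of_nat (Suc b)"]
    by (metis is_unit_triv of_nat_eq_0_iff of_nat_poly nat.simps(3))
  have pv: "\<not> p dvd v"
  proof
    assume "p dvd v"
    moreover have "v = p * (zvar * p * u\<^sup>2 - 4 * p * hir2 u
        - 4 * of_nat (Suc a) * u\<^sup>2 * pderiv (pderiv p))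
        + of_nat (Suc (4 * a + 3)) * (u\<^sup>2 * (pderiv p)\<^sup>2)"
      unfolding v_def hir2_def by (simp add: algebra_simps power2_eq_square)
    ultimately have "p dvd of_nat (Suc (4 * a + 3)) * (u\<^sup>2 * (pderiv p)\<^sup>2)"
      by (metis dvd_add_right_iff dvd_triv_left)
    then show False
      using p(1) nof pu pnp' by (metis prime_elem_dvd_multD prime_elem_dvd_power)
  qed
  have fg: "f * g = p ^ (2 * a) * v" using Th Tv by simp
  have "a > 0"
  proof (rule ccontr)
    assume "\<not> a > 0"
    then have "f * g = v" using fg by simp
    then show False using p(3) pv by auto
  qed
  then obtain b where b: "2 * a = Suc b" by (cases "2 * a") auto
  have "p ^ (2 * a) dvd f * g" using fg by simp
  then have "p ^ (2 * a) dvd f"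
    using p(1) png by (metis mult.commute prime_elem_imp_coprime coprime_dvd_mult_left_iff
        coprime_power_left_iff)
  then obtain y where y: "f = p ^ Suc b * y" using b by (auto simp: dvd_def)
  have "p ^ (2 * a) * (y * g) = p ^ (2 * a) * v" using fg y b by (simp add: algebra_simps)
  then have "y * g = v" using p(1) by (auto simp: prime_elem_def)
  then have py: "\<not> p dvd y" using pv by auto
  have pow: "pderiv (p ^ Suc b) = of_nat (Suc b) * p ^ b * pderiv p"
    unfolding pderiv_power_Suc by (simp only: of_nat_poly) simp
  have "pderiv f * g - f * pderiv g = p ^ b * (of_nat (Suc b) * (pderiv p * y * g)
      + p * (pderiv y * g - y * pderiv g))"
    unfolding y pderiv_mult pow by (simp add: algebra_simps del: of_nat_Suc)
  moreover have "c * h\<^sup>2 = p ^ b * (p * (c * p\<^sup>2 * u\<^sup>2))"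
  proof -
    have "h\<^sup>2 = p ^ (2 * a) * p\<^sup>2 * u\<^sup>2"
      unfolding h by (simp add: power_mult_distrib power_mult power2_eq_square algebra_simps)
    then show ?thesis unfolding b by (simp add: algebra_simps)
  qed
  ultimately have "p ^ b * (of_nat (Suc b) * (pderiv p * y * g)
      + p * (pderiv y * g - y * pderiv g)) = p ^ b * (p * (c * p\<^sup>2 * u\<^sup>2))"
    using R by (simp only:)
  then have "of_nat (Suc b) * (pderiv p * y * g)
      + p * (pderiv y * g - y * pderiv g) = p * (c * p\<^sup>2 * u\<^sup>2)"
    using p(1) by (simp only: mult_cancel_left) (auto simp: prime_elem_def)
  then have "p dvd of_nat (Suc b) * (pderiv p * y * g)"
    by (metis dvd_add_left_iff dvd_triv_left)
  then show False
    using p(1) nof pnp' py png by (metis prime_elem_dvd_multD)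
qed

lemma YV_invariant:
  "\<exists>g. toda (YV n) = YV (Suc n) * g \<and> YV n dvd toda g \<and> coprime g (YV n) \<and>
     pderiv (YV (Suc n)) * g - YV (Suc n) * pderiv g = of_nat (2 * n + 1) * (YV n)\<^sup>2 \<and>
     hirota (YV n) (YV (Suc n)) = 0 \<and> YV n \<noteq> 0 \<and> YV (Suc n) \<noteq> 0"
  "YV (Suc (Suc n)) * YV n = toda (YV (Suc n))"
proof -
  have step: "k * h = toda f \<and> coprime h f \<and> k \<noteq> 0 \<and>
     pderiv k * h - k * pderiv h = of_nat (2 * Suc n + 1) * f\<^sup>2 \<and> hirota f k = 0"
    if "toda h = f * g" "h dvd toda g" "coprime g h"
      "pderiv f * g - f * pderiv g = of_nat (2 * n + 1) * h\<^sup>2"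
      "hirota h f = 0" "h \<noteq> 0" "f \<noteq> 0" "k = toda f div h" for h f g k n
  proof -
    have "h dvd toda f * g\<^sup>2" using that by (intro dvd_step_aux) auto
    then have "h dvd toda f"
      using that(3) by (metis coprime_commute coprime_dvd_mult_left_iff coprime_power_right_iff)
    then have k: "toda f = k * h" using that(8) by simp
    have R: "pderiv k * h - k * pderiv h = (of_nat (2 * n + 1) + 2) * f\<^sup>2"
      by (rule wronskian_step[OF that(1) k that(5,4,6)])
    then have R': "pderiv k * h - k * pderiv h = of_nat (2 * Suc n + 1) * f\<^sup>2"
      by (simp add: algebra_simps)
    have "k \<noteq> 0"
    proof
      assume "k = 0"
      then have "of_nat (2 * Suc n + 1) * f\<^sup>2 = 0" using R' by simp
      then have "of_nat (2 * Suc n + 1) = (0 :: real poly)"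
        using that(7) by (metis mult_eq_0_iff power_not_zero)
      then show False by (metis of_nat_eq_0_iff add_is_0 one_neq_zero)
    qed
    then show ?thesis
      using k R' hirota_step[OF R' that(5,6)] coprime_step[OF that(1,3,4,6)] by simp
  qed
  show inv: "\<exists>g. toda (YV n) = YV (Suc n) * g \<and> YV n dvd toda g \<and> coprime g (YV n) \<and>
     pderiv (YV (Suc n)) * g - YV (Suc n) * pderiv g = of_nat (2 * n + 1) * (YV n)\<^sup>2 \<and>
     hirota (YV n) (YV (Suc n)) = 0 \<and> YV n \<noteq> 0 \<and> YV (Suc n) \<noteq> 0" for n
  proof (induction n)
    case 0
    show ?case
      by (rule exI[of _ 1]) (simp add: toda_def hirota_def pderiv_pCons)
  next
    case (Suc n)
    then obtain g where g: "toda (YV n) = YV (Suc n) * g" "YV n dvd toda g" "coprime g (YV n)"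
     "pderiv (YV (Suc n)) * g - YV (Suc n) * pderiv g = of_nat (2 * n + 1) * (YV n)\<^sup>2"
     "hirota (YV n) (YV (Suc n)) = 0" "YV n \<noteq> 0" "YV (Suc n) \<noteq> 0" by blast
    have "YV (Suc n) dvd toda (YV n)" using g(1) by simp
    then show ?case
      using step[OF g YV.simps(3)] g(7) by (intro exI[of _ "YV n"]) metis
  qed
  show "YV (Suc (Suc n)) * YV n = toda (YV (Suc n))"
    using inv[of n] step YV.simps(3) by blast
qed

theorem YV_recurrence:
  assumes "n \<ge> 1"
  shows "YV (n + 1) * YV (n - 1) =
    zvar * (YV n)\<^sup>2 - 4 * (YV n * pderiv (pderiv (YV n)) - (pderiv (YV n))\<^sup>2)"
  using YV_invariant(2)[of "n - 1"] assms by (simp add: toda_def)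

theorem YV_nonzero: "YV n \<noteq> 0"
  using YV_invariant(1)[of n] by blast

end

theory Submission
  imports Defs
begin

text \<open>
  Put \<open>p = YV (n + 2)\<close> and \<open>q = YV n\<close>. The Wronskian \<open>p' q - p q'\<close> is a positive multiple of
  \<open>(YV (n + 1))\<^sup>2\<close>, so the rational function \<open>p / q\<close> increases between any two consecutive
  poles. Since \<open>p\<close> and \<open>q\<close> have no common root, the real roots of \<open>p\<close> and of \<open>q\<close> alternate.
  Hence, on a half-line, the two numbers of roots differ by at most one, and the difference is
  decided by the behaviour of \<open>p / q\<close> at the two ends.

  At infinity the recurrence decides: \<open>p q = z (YV (n + 1))\<^sup>2 - \<dots>\<close> has odd degree and positive
  leading coefficient, so \<open>p / q\<close> is negative far to the left and positive far to the right.
  At zero one uses the symmetry of order three: the exponents that occur in \<open>YV n\<close> are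
  all congruent modulo \<open>3\<close>, to \<open>1\<close> if \<open>n\<close> is congruent to \<open>1\<close> and to \<open>0\<close> otherwise. So \<open>YV n\<close>
  vanishes at zero if \<open>n\<close> is congruent to \<open>1\<close>, and only then, because consecutive members have
  no common root. Hence \<open>p / q\<close> has a zero at the origin, or a pole, or
  (when \<open>YV (n + 1)\<close> vanishes there) a value whose sign is that of
  \<open>p q = 4 ((YV (n + 1))')\<^sup>2\<close>, which is positive.

  Comparing the alternation with these signs (\<open>interlacing_root_counts\<close>) shows that the step from
  \<open>n\<close> to \<open>n + 2\<close> adds one negative root unless \<open>p\<close> vanishes at zero, and
  adds a positive root exactly if \<open>q\<close> vanishes at zero. The formulas follow by induction.
\<close>

section \<open>Counting roots by interlacing\<close>

text \<open>Every element of \<open>A\<close> except the largest is sent to the first element of \<open>B\<close> above it;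
  separation makes this map injective.\<close>

lemma card_le_Suc_card_if_separated:
  fixes A B :: "'a :: linorder set"
  assumes "finite A" "finite B"
    and sep: "\<And>x y. x \<in> A \<Longrightarrow> y \<in> A \<Longrightarrow> x < y \<Longrightarrow> \<exists>z\<in>B. x < z \<and> z < y"
  shows "card A \<le> card B + 1"
proof (cases "A = {}")
  case False
  define next_B where "next_B x = Min {z \<in> B. x < z}" for x
  have next_B: "next_B x \<in> B" "x < next_B x" "next_B x < y"
    if xy: "x \<in> A" "y \<in> A" "x < y" for x y
  proof -
    obtain z where z: "z \<in> B" "x < z" "z < y" using sep[OF xy] by blast
    have "next_B x \<in> {z \<in> B. x < z}"
      unfolding next_B_def using z assms(2) by (intro Min_in) auto
    then show "next_B x \<in> B" "x < next_B x" by auto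
    have "next_B x \<le> z"
      unfolding next_B_def using z assms(2) by (intro Min_le) auto
    then show "next_B x < y" using z by simp
  qed
  have below_Max: "x < Max A" if "x \<in> A - {Max A}" for x
    using that assms(1) by (metis DiffD1 DiffD2 Max_ge insertI1 order_le_less)
  have "inj_on next_B (A - {Max A})"
  proof (rule linorder_inj_onI)
    fix x y assume xy: "x < y" "x \<in> A - {Max A}" "y \<in> A - {Max A}"
    then have "next_B x < y" "y < next_B y"
      using next_B[of x y] next_B[of y "Max A"] below_Max[of y] assms(1) False by auto
    then show "next_B x \<noteq> next_B y" by simp
  qed auto
  moreover have "next_B ` (A - {Max A}) \<subseteq> B"
    using next_B(1)[of _ "Max A"] below_Max Max_in[OF assms(1) False] by blast
  ultimately have "card (A - {Max A}) \<le> card B"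
    using assms(2) by (metis card_inj_on_le)
  then show ?thesis using assms(1) False by (simp add: card_Diff_singleton)
qed simp

text \<open>Without a root of \<open>g\<close>, the quotient \<open>f / g\<close> is nondecreasing on the interval although it
  is nonnegative at the left end and nonpositive at the right end. Then it is identically zero
  there, which no nonzero \<open>f\<close> allows. The Wronskian of the application is a multiple of a square
  and does have zeros, which is why it is taken nonnegative and not positive.\<close>

lemma root_in_gap:
  fixes f g :: "real poly"
  assumes wronskian: "\<And>x. 0 \<le> poly (pderiv f * g - f * pderiv g) x"
    and "f \<noteq> 0" and "x < y" and "poly g x \<noteq> 0" "poly g y \<noteq> 0"
    and "0 \<le> poly f x * poly g x" "poly f y * poly g y \<le> 0"
  shows "\<exists>z. x < z \<and> z < y \<and> poly g z = 0"
proof (rule ccontr)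
  assume no_root: "\<not> ?thesis"
  have g: "poly g z \<noteq> 0" if "x \<le> z" "z \<le> y" for z
    using no_root that assms(4,5) by (metis order_le_less)
  define r where "r z = poly f z / poly g z" for z
  have mono: "r s \<le> r t" if "x \<le> s" "s \<le> t" "t \<le> y" for s t
  proof (rule DERIV_nonneg_imp_nondecreasing[OF that(2)])
    fix z assume z: "s \<le> z" "z \<le> t"
    have gz: "poly g z \<noteq> 0" using g z that by auto
    have "(r has_real_derivative (poly (pderiv f) z * poly g z - poly f z * poly (pderiv g) z)
      / (poly g z * poly g z)) (at z)"
      unfolding r_def by (intro DERIV_divide poly_DERIV gz)
    moreover have "0 \<le> (poly (pderiv f) z * poly g z - poly f z * poly (pderiv g) z)
      / (poly g z * poly g z)"
      using wronskian[of z] by simp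
    ultimately show "\<exists>d. (r has_real_derivative d) (at z) \<and> 0 \<le> d" by blast
  qed
  have "0 \<le> r x" "r y \<le> 0"
    using assms(6,7) unfolding r_def
    by (auto simp: zero_le_divide_iff divide_le_0_iff zero_le_mult_iff mult_le_0_iff)
  then have "r z = 0" if "z \<in> {x..y}" for z
    using mono[of x z] mono[of z y] that by auto
  then have "{x..y} \<subseteq> {z. poly f z = 0}"
    using g unfolding r_def by force
  then have "finite {x..y}"
    using poly_roots_finite[OF \<open>f \<noteq> 0\<close>] finite_subset by blast
  then show False using infinite_Icc[OF \<open>x < y\<close>] by simp
qed

text \<open>The set \<open>A\<close> may contain, besides roots of \<open>f\<close>, the end points of the interval as
  sentinels. Each sentinel at which \<open>f / g\<close> has the right sign forces one more root of \<open>g\<close>.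
  This is why the sign conditions skip \<open>b\<close> and \<open>a\<close> respectively: an end point is
  never the left, respectively the right, member of a pair.\<close>

lemma card_le_Suc_card_roots:
  fixes f g :: "real poly" and a b :: real
  assumes wronskian: "\<And>x. 0 \<le> poly (pderiv f * g - f * pderiv g) x"
    and "f \<noteq> 0" "g \<noteq> 0" and "finite A" and A: "A \<subseteq> {a..b}"
    and g: "\<And>x. x \<in> A \<Longrightarrow> poly g x \<noteq> 0"
    and nonneg: "\<And>x. x \<in> A \<Longrightarrow> x < b \<Longrightarrow> 0 \<le> poly f x * poly g x"
    and nonpos: "\<And>x. x \<in> A \<Longrightarrow> a < x \<Longrightarrow> poly f x * poly g x \<le> 0"
  shows "card A \<le> card ({x. poly g x = 0} \<inter> {a<..<b}) + 1"
proof (rule card_le_Suc_card_if_separated[OF \<open>finite A\<close>])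
  show "finite ({x. poly g x = 0} \<inter> {a<..<b})"
    using poly_roots_finite[OF \<open>g \<noteq> 0\<close>] by blast
  fix x y assume xy: "x \<in> A" "y \<in> A" "x < y"
  then have "a \<le> x" "y \<le> b" using A by auto
  then have "\<exists>z. x < z \<and> z < y \<and> poly g z = 0"
    using xy g nonneg nonpos by (intro root_in_gap[OF wronskian \<open>f \<noteq> 0\<close>]) auto
  then show "\<exists>z\<in>{x. poly g x = 0} \<inter> {a<..<b}. x < z \<and> z < y"
    using \<open>a \<le> x\<close> \<open>y \<le> b\<close> by auto
qed

text \<open>The behaviour at \<open>-\<infinity>\<close> is that of \<open>- t (- x)\<close> at \<open>+\<infinity>\<close>, a polynomial with the same leading
  coefficient because the degree is odd.\<close>

lemma odd_degree_signs:
  fixes t :: "real poly"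
  assumes "odd (degree t)" "0 < lead_coeff t"
  obtains M where "0 < M" "\<And>x. M \<le> x \<Longrightarrow> 0 < poly t x" "\<And>x. x \<le> - M \<Longrightarrow> poly t x < 0"
proof -
  define s where "s = - (t \<circ>\<^sub>p [:0, - 1:])"
  have "lead_coeff s = lead_coeff t"
    unfolding s_def using assms(1) lead_coeff_comp[of "[:0, - 1 :: real:]" t]
    by (simp add: lead_coeff_minus)
  then obtain M1 M2 where M: "\<And>x. M1 \<le> x \<Longrightarrow> lead_coeff t \<le> poly t x"
    "\<And>x. M2 \<le> x \<Longrightarrow> lead_coeff s \<le> poly s x"
    using poly_pinfty_gt_lc[of t] poly_pinfty_gt_lc[of s] assms(2) by auto
  show thesis
  proof (rule that[of "max 1 (max M1 M2)"])
    show "0 < poly t x" if "max 1 (max M1 M2) \<le> x" for x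
      using M(1)[of x] that assms(2) by simp
    show "poly t x < 0" if "x \<le> - max 1 (max M1 M2)" for x
    proof -
      have "0 < poly s (- x)"
        using M(2)[of "- x"] that assms(2) \<open>lead_coeff s = lead_coeff t\<close> by linarith
      then show ?thesis by (simp add: s_def poly_pcompose)
    qed
  qed simp
qed

text \<open>The pair \<open>(- q, p)\<close> has the same Wronskian as \<open>(p, q)\<close>, so the counting lemma bounds the roots
  of \<open>p\<close> and of \<open>q\<close> against each other in both directions. The sentinels are the origin and a
  point \<open>\<plusminus>M\<close> beyond all roots. The point \<open>\<plusminus>M\<close> always fits the roots of \<open>q\<close>. The origin fits
  the roots of \<open>q\<close> or those of \<open>p\<close>, according to whether \<open>p / q\<close> has a zero, a pole or a
  positive value there.\<close>

lemma interlacing_root_counts: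
  fixes p q :: "real poly"
  assumes wronskian: "\<And>x. 0 \<le> poly (pderiv p * q - p * pderiv q) x"
    and disjoint: "\<And>x. poly p x = 0 \<Longrightarrow> poly q x \<noteq> 0"
    and pq_lead: "odd (degree (p * q))" "0 < lead_coeff (p * q)"
    and pq_0: "0 \<le> poly p 0 * poly q 0"
  shows "card ({x. poly p x = 0} \<inter> {..<0}) =
      card ({x. poly q x = 0} \<inter> {..<0}) + (if poly p 0 = 0 then 0 else 1)"
    and "card ({x. poly p x = 0} \<inter> {0<..}) =
      card ({x. poly q x = 0} \<inter> {0<..}) + (if poly q 0 = 0 then 1 else 0)"
proof -
  have nz: "p \<noteq> 0" "q \<noteq> 0" using pq_lead(2) by auto
  obtain M where M: "0 < M" "\<And>x. M \<le> x \<Longrightarrow> 0 < poly p x * poly q x"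
    "\<And>x. x \<le> - M \<Longrightarrow> poly p x * poly q x < 0"
    using odd_degree_signs[OF pq_lead] by auto
  have bound: "- M < x" "x < M" if "poly p x * poly q x = 0" for x
    using M(2)[of x] M(3)[of x] that by (auto simp: not_less[symmetric])
  have p_root: "poly q x \<noteq> 0 \<and> - M < x \<and> x < M" if "poly p x = 0" for x
    using disjoint[OF that] bound[of x] that by simp
  have q_root: "poly p x \<noteq> 0 \<and> - M < x \<and> x < M" if "poly q x = 0" for x
    using disjoint[of x] bound[of x] that by auto
  have signs: "0 < poly p M * poly q M" "poly p (- M) * poly q (- M) < 0"
    using M(2,3) by simp_all
  then have M_nz: "poly p M \<noteq> 0" "poly p (- M) \<noteq> 0" by auto
  define N P where "N f = {x. poly f x = 0} \<inter> {..<0}" and "P f = {x. poly f x = 0} \<inter> {0<..}"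
    for f :: "real poly"
  have fin: "finite (N p)" "finite (P p)" "finite (N q)" "finite (P q)"
    using nz unfolding N_def P_def by (simp_all add: poly_roots_finite)
  have N_eq: "{x. poly p x = 0} \<inter> {- M<..<0} = N p" "{x. poly q x = 0} \<inter> {- M<..<0} = N q"
    and P_eq: "{x. poly p x = 0} \<inter> {0<..<M} = P p" "{x. poly q x = 0} \<inter> {0<..<M} = P q"
    using p_root q_root unfolding N_def P_def by auto
  have N_D: "x \<in> N p \<Longrightarrow> poly p x = 0 \<and> x < 0 \<and> poly q x \<noteq> 0 \<and> - M < x"
    "x \<in> N q \<Longrightarrow> poly q x = 0 \<and> x < 0 \<and> poly p x \<noteq> 0 \<and> - M < x" for x
    using p_root q_root by (simp_all add: N_def)
  have P_D: "x \<in> P p \<Longrightarrow> poly p x = 0 \<and> 0 < x \<and> poly q x \<noteq> 0 \<and> x < M"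
    "x \<in> P q \<Longrightarrow> poly q x = 0 \<and> 0 < x \<and> poly p x \<noteq> 0 \<and> x < M" for x
    using p_root q_root by (simp_all add: P_def)
  have wronskian': "0 \<le> poly (pderiv (- q) * p - (- q) * pderiv p) x" for x
    using wronskian[of x] by (simp add: pderiv_minus algebra_simps)
  have count_q: "card A \<le> card ({x. poly q x = 0} \<inter> {a<..<b}) + 1"
    if "finite A" "A \<subseteq> {a..b}" "\<And>x. x \<in> A \<Longrightarrow> poly q x \<noteq> 0"
      "\<And>x. x \<in> A \<Longrightarrow> x < b \<Longrightarrow> 0 \<le> poly p x * poly q x"
      "\<And>x. x \<in> A \<Longrightarrow> a < x \<Longrightarrow> poly p x * poly q x \<le> 0" for A a b
    using that by (rule card_le_Suc_card_roots[OF wronskian nz])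
  have count_p: "card A \<le> card ({x. poly p x = 0} \<inter> {a<..<b}) + 1"
    if "finite A" "A \<subseteq> {a..b}" "\<And>x. x \<in> A \<Longrightarrow> poly p x \<noteq> 0"
      "\<And>x. x \<in> A \<Longrightarrow> x < b \<Longrightarrow> poly p x * poly q x \<le> 0"
      "\<And>x. x \<in> A \<Longrightarrow> a < x \<Longrightarrow> 0 \<le> poly p x * poly q x" for A a b
    using that nz by (intro card_le_Suc_card_roots[OF wronskian']) (auto simp: mult.commute)

  have "card (N p) \<le> card (N q) + 1"
    by (rule count_q[of _ "- M" 0, unfolded N_eq])
      (use fin in \<open>auto dest!: N_D\<close>)
  moreover have "card (insert 0 (N p)) \<le> card (N q) + 1" if "poly p 0 = 0"
    by (rule count_q[of _ "- M" 0, unfolded N_eq])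
      (use fin M(1) disjoint[OF that] that in \<open>auto dest!: N_D\<close>)
  moreover have "card (insert (- M) (N q)) \<le> card (N p) + 1"
    by (rule count_p[of _ "- M" 0, unfolded N_eq])
      (use fin M(1) M_nz signs in \<open>auto dest!: N_D\<close>)
  moreover have "card (insert (- M) (insert 0 (N q))) \<le> card (N p) + 1" if "poly p 0 \<noteq> 0"
    by (rule count_p[of _ "- M" 0, unfolded N_eq])
      (use fin M(1) M_nz signs pq_0 that in \<open>auto dest!: N_D\<close>)
  moreover have "0 \<notin> N p" "0 \<notin> N q" "- M \<notin> N q"
    using N_D by fastforce+
  ultimately show "card ({x. poly p x = 0} \<inter> {..<0}) =
      card ({x. poly q x = 0} \<inter> {..<0}) + (if poly p 0 = 0 then 0 else 1)"
    using fin M(1) unfolding N_def[symmetric] by auto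

  have "card (P p) \<le> card (P q) + 1"
    by (rule count_q[of _ 0 M, unfolded P_eq])
      (use fin in \<open>auto dest!: P_D\<close>)
  moreover have "card (insert 0 (P p)) \<le> card (P q) + 1" if "poly q 0 \<noteq> 0"
    by (rule count_q[of _ 0 M, unfolded P_eq])
      (use fin M(1) pq_0 that in \<open>auto dest!: P_D\<close>)
  moreover have "card (insert M (P q)) \<le> card (P p) + 1"
    by (rule count_p[of _ 0 M, unfolded P_eq])
      (use fin M(1) M_nz signs in \<open>auto dest!: P_D\<close>)
  moreover have "card (insert M (insert 0 (P q))) \<le> card (P p) + 1" if "poly q 0 = 0"
    by (rule count_p[of _ 0 M, unfolded P_eq])
      (use fin M(1) M_nz signs disjoint[of 0] that in \<open>auto dest!: P_D\<close>)
  moreover have "0 \<notin> P p" "0 \<notin> P q" "M \<notin> P q"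
    using P_D by fastforce+
  ultimately show "card ({x. poly p x = 0} \<inter> {0<..}) =
      card ({x. poly q x = 0} \<inter> {0<..}) + (if poly q 0 = 0 then 1 else 0)"
    using fin M(1) unfolding P_def[symmetric] by auto
qed

section \<open>Neighbours in the sequence\<close>

lemma degree_lead_coeff_toda:
  assumes "q \<noteq> 0"
  shows "degree (toda q) = 2 * degree q + 1" "lead_coeff (toda q) = (lead_coeff q)\<^sup>2"
proof -
  have "degree (hir2 q) \<le> 2 * degree q"
  proof -
    have "degree (q * pderiv (pderiv q)) \<le> 2 * degree q"
      by (rule order_trans[OF degree_mult_le]) (simp add: degree_pderiv)
    moreover have "degree ((pderiv q)\<^sup>2) \<le> 2 * degree q"
      unfolding power2_eq_square
      by (rule order_trans[OF degree_mult_le]) (simp add: degree_pderiv)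
    ultimately show ?thesis unfolding hir2_def by (rule degree_diff_le)
  qed
  moreover have "4 * hir2 q = smult 4 (hir2 q)"
    by (simp add: numeral_poly)
  moreover have main: "degree (zvar * q\<^sup>2) = 2 * degree q + 1"
    using assms by (simp add: degree_mult_eq degree_power_eq del: mult_pCons_left)
  moreover have main_lead: "lead_coeff (zvar * q\<^sup>2) = (lead_coeff q)\<^sup>2"
    unfolding lead_coeff_mult lead_coeff_power by simp
  ultimately have small: "degree (- (4 * hir2 q)) < degree (zvar * q\<^sup>2)" by simp
  have "toda q = zvar * q\<^sup>2 + (- (4 * hir2 q))" by (simp add: toda_hir2)
  then show "degree (toda q) = 2 * degree q + 1" "lead_coeff (toda q) = (lead_coeff q)\<^sup>2"
    using degree_add_eq_left[OF small] lead_coeff_add_le[OF small] main main_lead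
    by (simp_all only: add.commute)
qed

text \<open>The polynomial \<open>g\<close> supplied by \<open>YV_invariant\<close> at index \<open>n + 1\<close> is \<open>YV n\<close>, because the
  recurrence determines it after cancelling \<open>YV (n + 2)\<close>.\<close>

lemma YV_neighbours:
  shows "coprime (YV n) (YV (Suc n))"
    and "pderiv (YV (Suc (Suc n))) * YV n - YV (Suc (Suc n)) * pderiv (YV n)
      = of_nat (2 * n + 3) * (YV (Suc n))\<^sup>2"
proof -
  obtain g where g: "toda (YV (Suc n)) = YV (Suc (Suc n)) * g" "coprime g (YV (Suc n))"
    "pderiv (YV (Suc (Suc n))) * g - YV (Suc (Suc n)) * pderiv g
      = of_nat (2 * Suc n + 1) * (YV (Suc n))\<^sup>2"
    using YV_invariant(1)[of "Suc n"] by blast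
  have "YV (Suc (Suc n)) * g = YV (Suc (Suc n)) * YV n"
    using g(1) YV_invariant(2)[of n] by simp
  then have "g = YV n" using YV_nonzero by (simp del: YV.simps)
  then show "coprime (YV n) (YV (Suc n))"
    "pderiv (YV (Suc (Suc n))) * YV n - YV (Suc (Suc n)) * pderiv (YV n)
      = of_nat (2 * n + 3) * (YV (Suc n))\<^sup>2"
    using g(2,3) by (simp_all add: numeral_3_eq_3)
qed

lemma YV_no_consecutive_common_root:
  assumes "poly (YV n) x = 0"
  shows "poly (YV (Suc n)) x \<noteq> 0"
proof
  assume "poly (YV (Suc n)) x = 0"
  then have "[:- x, 1:] dvd YV n" "[:- x, 1:] dvd YV (Suc n)"
    using assms by (simp_all add: poly_eq_0_iff_dvd)
  then have "is_unit [:- x, 1:]"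
    using YV_neighbours(1)[of n] by (metis coprime_common_divisor)
  then show False by (simp add: is_unit_iff_degree)
qed

lemma YV_wronskian_poly:
  "poly (pderiv (YV (Suc (Suc n))) * YV n - YV (Suc (Suc n)) * pderiv (YV n)) x
    = (2 * real n + 3) * (poly (YV (Suc n)) x)\<^sup>2"
  unfolding YV_neighbours(2) by (simp add: poly_of_nat)

text \<open>At a common root the Wronskian vanishes, hence so does \<open>YV (n + 1)\<close>, which is impossible for
  two consecutive members.\<close>

lemma YV_no_common_root_step_two:
  assumes "poly (YV (Suc (Suc n))) x = 0"
  shows "poly (YV n) x \<noteq> 0"
proof
  assume "poly (YV n) x = 0"
  then have "(2 * real n + 3) * (poly (YV (Suc n)) x)\<^sup>2 = 0"
    using assms YV_wronskian_poly[of n x] by simp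
  moreover have "2 * real n + 3 \<noteq> 0" by linarith
  ultimately have "poly (YV (Suc n)) x = 0" by simp
  then show False using assms YV_no_consecutive_common_root by blast
qed

section \<open>The value at zero\<close>

text \<open>The real form of the symmetry \<open>p (\<omega> z) = \<omega>\<^sup>r p (z)\<close> for a primitive cube root of unity
  \<open>\<omega>\<close>.\<close>

definition exponents_cong :: "nat \<Rightarrow> real poly \<Rightarrow> bool" where
  "exponents_cong r p \<longleftrightarrow> (\<forall>i. coeff p i \<noteq> 0 \<longrightarrow> i mod 3 = r mod 3)"

lemma exponents_cong_mod: "r mod 3 = s mod 3 \<Longrightarrow> exponents_cong r p \<Longrightarrow> exponents_cong s p"
  by (simp add: exponents_cong_def)

lemma exponents_cong_mult:
  assumes "exponents_cong r p" "exponents_cong s q"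
  shows "exponents_cong (r + s) (p * q)"
  unfolding exponents_cong_def
proof (intro allI impI)
  fix n assume "coeff (p * q) n \<noteq> 0"
  then obtain i where "i \<in> {..n}" "coeff p i * coeff q (n - i) \<noteq> 0"
    unfolding coeff_mult by (rule sum.not_neutral_contains_not_neutral)
  then have i: "i \<le> n" "coeff p i \<noteq> 0" "coeff q (n - i) \<noteq> 0" by auto
  then have "i mod 3 = r mod 3" "(n - i) mod 3 = s mod 3"
    using assms by (auto simp: exponents_cong_def)
  then have "(i + (n - i)) mod 3 = (r + s) mod 3" by (rule mod_add_cong)
  then show "n mod 3 = (r + s) mod 3" using i(1) by simp
qed

lemma exponents_cong_diff:
  "exponents_cong r p \<Longrightarrow> exponents_cong r q \<Longrightarrow> exponents_cong r (p - q)"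
  unfolding exponents_cong_def by force

text \<open>Differentiation lowers exponents by one; \<open>r + 2\<close> replaces \<open>r - 1\<close> to stay within the
  natural numbers.\<close>

lemma exponents_cong_pderiv: "exponents_cong r p \<Longrightarrow> exponents_cong (r + 2) (pderiv p)"
  unfolding exponents_cong_def coeff_pderiv
proof (intro allI impI)
  fix i assume p: "\<forall>i. coeff p i \<noteq> 0 \<longrightarrow> i mod 3 = r mod 3"
    and "of_nat (Suc i) * coeff p (Suc i) \<noteq> 0"
  then have "Suc i mod 3 = r mod 3" by auto
  then show "i mod 3 = (r + 2) mod 3" by presburger
qed

lemma exponents_cong_toda:
  assumes "exponents_cong r q"
  shows "exponents_cong (1 + 2 * r) (toda q)"
proof -
  have z: "exponents_cong 1 zvar"
    by (auto simp: exponents_cong_def coeff_pCons split: nat.splits)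
  have four: "exponents_cong 0 4"
    by (auto simp: exponents_cong_def numeral_poly coeff_pCons split: nat.splits)
  note d = exponents_cong_pderiv[OF assms] exponents_cong_pderiv[OF exponents_cong_pderiv[OF assms]]
  have "exponents_cong (1 + 2 * r) (zvar * q\<^sup>2)"
    unfolding power2_eq_square
    by (rule exponents_cong_mod[OF _ exponents_cong_mult[OF z exponents_cong_mult[OF assms assms]]])
      presburger
  moreover have "exponents_cong (1 + 2 * r) (4 * (q * pderiv (pderiv q) - (pderiv q)\<^sup>2))"
    unfolding power2_eq_square
  proof (rule exponents_cong_mod[OF _ exponents_cong_mult[OF four exponents_cong_diff]])
    show "exponents_cong (r + (r + 2 + 2)) (q * pderiv (pderiv q))"
      by (rule exponents_cong_mult[OF assms d(2)])
    show "exponents_cong (r + (r + 2 + 2)) (pderiv q * pderiv q)"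
      by (rule exponents_cong_mod[OF _ exponents_cong_mult[OF d(1) d(1)]]) presburger
  qed presburger
  ultimately show ?thesis unfolding toda_def by (rule exponents_cong_diff)
qed

lemma mod_add_right_cancel:
  fixes x y u v m :: nat
  assumes "(x + y) mod m = (u + v) mod m" "y mod m = v mod m"
  shows "x mod m = u mod m"
proof -
  have "(int x + int y) mod int m = (int u + int v) mod int m" "int y mod int m = int v mod int m"
    using assms by (simp_all flip: of_nat_add of_nat_mod)
  then have "(int x + int y - int y) mod int m = (int u + int v - int v) mod int m"
    by (rule mod_diff_cong)
  then show ?thesis by (simp flip: of_nat_mod)
qed

text \<open>This carries the symmetry through the division in the recurrence. Take the lowest
  exponent \<open>i\<close> of \<open>p\<close> in a wrong class and the lowest exponent \<open>j\<close> of \<open>q\<close>. In the coefficient of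
  \<open>p q\<close> at \<open>i + j\<close> only exponents of \<open>p\<close> in the class of \<open>i\<close> can contribute, and by minimality
  just one term is left. So \<open>p q\<close> has an exponent in a wrong class.\<close>

lemma exponents_cong_cancel:
  assumes "exponents_cong (r + s) (p * q)" "exponents_cong s q" "q \<noteq> 0"
  shows "exponents_cong r p"
proof (rule ccontr)
  assume "\<not> exponents_cong r p"
  then have ex_i: "\<exists>i. coeff p i \<noteq> 0 \<and> i mod 3 \<noteq> r mod 3"
    by (simp add: exponents_cong_def)
  define i where "i = (LEAST i. coeff p i \<noteq> 0 \<and> i mod 3 \<noteq> r mod 3)"
  have i: "coeff p i \<noteq> 0" "i mod 3 \<noteq> r mod 3"
    unfolding i_def using LeastI_ex[OF ex_i] by auto
  have i_le: "i \<le> b" if "coeff p b \<noteq> 0" "b mod 3 \<noteq> r mod 3" for b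
    unfolding i_def using that by (intro Least_le) auto
  have ex_j: "\<exists>j. coeff q j \<noteq> 0" using assms(3) by (auto simp: poly_eq_iff)
  define j where "j = (LEAST j. coeff q j \<noteq> 0)"
  have j: "coeff q j \<noteq> 0" unfolding j_def using LeastI_ex[OF ex_j] .
  have j_le: "j \<le> b" if "coeff q b \<noteq> 0" for b
    unfolding j_def using that by (intro Least_le) auto
  have "coeff p b * coeff q (i + j - b) = 0" if "b \<le> i + j" "b \<noteq> i" for b
  proof (rule ccontr)
    assume "coeff p b * coeff q (i + j - b) \<noteq> 0"
    then have nz: "coeff p b \<noteq> 0" "coeff q (i + j - b) \<noteq> 0" by auto
    then have "(i + j - b) mod 3 = j mod 3"
      using assms(2) j by (simp add: exponents_cong_def)
    moreover have "(b + (i + j - b)) mod 3 = (i + j) mod 3" using that(1) by simp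
    ultimately have "b mod 3 = i mod 3" by (metis mod_add_right_cancel)
    then have "i \<le> b" using i_le nz(1) i(2) by auto
    moreover have "b \<le> i" using j_le[OF nz(2)] that(1) by simp
    ultimately show False using that(2) by simp
  qed
  then have "coeff (p * q) (i + j) = (\<Sum>b\<in>{i}. coeff p b * coeff q (i + j - b))"
    unfolding coeff_mult by (intro sum.mono_neutral_right) auto
  then have "coeff (p * q) (i + j) \<noteq> 0" using i(1) j by simp
  then have "(i + j) mod 3 = (r + s) mod 3" "j mod 3 = s mod 3"
    using assms(1,2) j by (auto simp: exponents_cong_def)
  then show False using i(2) mod_add_right_cancel by blast
qed

text \<open>The residue is that of the degree \<open>n (n + 1) / 2\<close>.\<close>

lemma exponents_cong_YV: "exponents_cong (if n mod 3 = 1 then 1 else 0) (YV n)"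
proof (induction n rule: YV.induct)
  case 1
  show ?case by (auto simp: exponents_cong_def coeff_pCons split: nat.splits)
next
  case 2
  show ?case by (auto simp: exponents_cong_def coeff_pCons split: nat.splits)
next
  case (3 n)
  have "exponents_cong (1 + 2 * (if Suc n mod 3 = 1 then 1 else 0))
      (YV (Suc (Suc n)) * YV n)"
    unfolding YV_invariant(2) by (rule exponents_cong_toda[OF 3(1)])
  then have "exponents_cong ((if Suc (Suc n) mod 3 = 1 then 1 else 0) + (if n mod 3 = 1 then 1 else 0))
      (YV (Suc (Suc n)) * YV n)"
    by (rule exponents_cong_mod[rotated])
      (use mod_less_divisor[of 3 n] in \<open>auto simp: mod_Suc\<close>)
  then show ?case by (rule exponents_cong_cancel[OF _ 3(2) YV_nonzero])
qed

text \<open>In the residue class of \<open>1\<close> the constant term is missing. Every other index has a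
  neighbour in that class, and consecutive members have no common root.\<close>

lemma YV_0_eq_0_iff: "poly (YV n) 0 = 0 \<longleftrightarrow> n mod 3 = 1"
proof -
  have zero: "poly (YV m) 0 = 0" if "m mod 3 = 1" for m
    using exponents_cong_YV[of m] that by (auto simp: exponents_cong_def poly_0_coeff_0)
  have "poly (YV n) 0 \<noteq> 0" if "n mod 3 \<noteq> 1"
  proof (cases "n mod 3 = 0")
    case True
    then have "Suc n mod 3 = 1" by presburger
    then show ?thesis using zero YV_no_consecutive_common_root by blast
  next
    case False
    then obtain m where m: "n = Suc m" by (cases n) auto
    then have "m mod 3 = 1" using False that by (auto simp: mod_Suc split: if_splits)
    then show ?thesis using m zero YV_no_consecutive_common_root by blast
  qed
  then show ?thesis using zero by blast
qed

text \<open>If \<open>YV (n + 1)\<close> vanishes at zero, the recurrence turns the product into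
  \<open>4 (YV (n + 1))'\<^sup>2\<close>; otherwise one of the two factors vanishes there.\<close>

lemma YV_product_0_nonneg: "0 \<le> poly (YV (Suc (Suc n))) 0 * poly (YV n) 0"
proof (cases "Suc n mod 3 = 1")
  case True
  have "poly (YV (Suc (Suc n))) 0 * poly (YV n) 0 = poly (toda (YV (Suc n))) 0"
    unfolding poly_mult[symmetric] YV_invariant(2) ..
  also have "\<dots> = 4 * (poly (pderiv (YV (Suc n))) 0)\<^sup>2"
    using True YV_0_eq_0_iff[of "Suc n"]
    by (simp add: toda_def numeral_poly del: YV.simps)
  finally show ?thesis by simp
next
  case False
  then have "n mod 3 = 1 \<or> Suc (Suc n) mod 3 = 1" by presburger
  then show ?thesis using YV_0_eq_0_iff by (metis mult_zero_left mult_zero_right order_refl)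
qed

section \<open>Counting the real roots\<close>

lemma card_YV_real_roots_step:
  "card (YV_real_roots (Suc (Suc n)) \<inter> {..<0}) =
     card (YV_real_roots n \<inter> {..<0}) + (if n mod 3 = 2 then 0 else 1)"
  "card (YV_real_roots (Suc (Suc n)) \<inter> {0<..}) =
     card (YV_real_roots n \<inter> {0<..}) + (if n mod 3 = 1 then 1 else 0)"
proof -
  have lead: "odd (degree (YV (Suc (Suc n)) * YV n))" "0 < lead_coeff (YV (Suc (Suc n)) * YV n)"
    unfolding YV_invariant(2) using degree_lead_coeff_toda[OF YV_nonzero] YV_nonzero
    by simp_all
  have "0 \<le> poly (pderiv (YV (Suc (Suc n))) * YV n - YV (Suc (Suc n)) * pderiv (YV n)) x" for x
    unfolding YV_wronskian_poly by simp
  note counts = interlacing_root_counts[OF this YV_no_common_root_step_two lead YV_product_0_nonneg]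
  have "Suc (Suc n) mod 3 = 1 \<longleftrightarrow> n mod 3 = 2" by presburger
  then show "card (YV_real_roots (Suc (Suc n)) \<inter> {..<0}) =
     card (YV_real_roots n \<inter> {..<0}) + (if n mod 3 = 2 then 0 else 1)"
    "card (YV_real_roots (Suc (Suc n)) \<inter> {0<..}) =
     card (YV_real_roots n \<inter> {0<..}) + (if n mod 3 = 1 then 1 else 0)"
    using counts unfolding YV_real_roots_def YV_0_eq_0_iff by auto
qed

lemma card_YV_negative_roots: "card (YV_real_roots n \<inter> {..<0}) = (n + 1) div 3"
proof (induction n rule: induct_nat_012)
  case 0
  show ?case by (simp add: YV_real_roots_def)
next
  case 1
  show ?case by (simp add: YV_real_roots_def)
next
  case (ge2 n)
  show ?case unfolding card_YV_real_roots_step ge2(1) by presburger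
qed

text \<open>Halving reduces each parity class to the rule for incrementing a quotient by \<open>3\<close>.\<close>

lemma positive_root_count_step:
  fixes n :: nat
  shows "(if even n then n div 6 else (n + 3) div 6) + (if n mod 3 = 1 then 1 else 0) =
    (if even (Suc (Suc n)) then Suc (Suc n) div 6 else (Suc (Suc n) + 3) div 6)"
proof (cases "even n")
  case True
  then obtain k where k: "n = 2 * k" by blast
  have "n div 6 = k div 3" "Suc (Suc n) div 6 = (k + 1) div 3"
    unfolding k using div_mult_mult1[of 2 k 3] div_mult_mult1[of 2 "k + 1" 3] by simp_all
  moreover have "n mod 3 = 1 \<longleftrightarrow> k mod 3 = 2" unfolding k by presburger
  moreover have "k div 3 + (if k mod 3 = 2 then 1 else 0) = (k + 1) div 3" by presburger
  ultimately show ?thesis using True by simp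
next
  case False
  then obtain k where k: "n = 2 * k + 1" by (rule oddE)
  have "(n + 3) div 6 = (k + 2) div 3" "(Suc (Suc n) + 3) div 6 = (k + 3) div 3"
    unfolding k using div_mult_mult1[of 2 "k + 2" 3] div_mult_mult1[of 2 "k + 3" 3] by simp_all
  moreover have "n mod 3 = 1 \<longleftrightarrow> k mod 3 = 0" unfolding k by presburger
  moreover have "(k + 2) div 3 + (if k mod 3 = 0 then 1 else 0) = (k + 3) div 3" by presburger
  ultimately show ?thesis using False by simp
qed

lemma card_YV_positive_roots:
  "card (YV_real_roots n \<inter> {0<..}) = (if even n then n div 6 else (n + 3) div 6)"
proof (induction n rule: induct_nat_012)
  case 0
  show ?case by (simp add: YV_real_roots_def)
next
  case 1
  show ?case by (simp add: YV_real_roots_def)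
next
  case (ge2 n)
  show ?case unfolding card_YV_real_roots_step ge2(1) by (rule positive_root_count_step)
qed

theorem theorem3:
  fixes n :: nat
  shows "int (card (YV_real_roots n \<inter> {..<0})) = \<lfloor>(real n + 1) / 3\<rfloor>
    \<and> int (card (YV_real_roots n \<inter> {0<..})) =
        (if even n then \<lfloor>real n / 6\<rfloor> else \<lfloor>(real n + 3) / 6\<rfloor>)"
proof -
  have "\<lfloor>(real n + 1) / 3\<rfloor> = int ((n + 1) div 3)" "\<lfloor>real n / 6\<rfloor> = int (n div 6)"
    "\<lfloor>(real n + 3) / 6\<rfloor> = int ((n + 3) div 6)"
    using floor_divide_of_nat_eq[of "n + 1" 3, where ?'a = real]
      floor_divide_of_nat_eq[of n 6, where ?'a = real]
      floor_divide_of_nat_eq[of "n + 3" 6, where ?'a = real]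
    by (simp_all add: add.commute)
  then show ?thesis unfolding card_YV_negative_roots card_YV_positive_roots by simp
qed

end
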